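(* Let $(P,\cdot,[\cdot,\cdot])$ be a finite-dimensional transposed Poisson algebra over $\Bbbk$. Then $(P,\cdot,[\cdot,\cdot])$ is solvable if and only if $(P,\cdot)$ is solvable and $(P,[\cdot,\cdot])$ is solvable.
   Context: $\Bbbk$ is an algebraically closed field of characteristic $0$. A transposed Poisson algebra is a triple $(P,\cdot,[\cdot,\cdot])$ where $(P,\cdot)$ is a commutative associative algebra (not necessarily unital), $(P,[\cdot,\cdot])$ is a Lie algebra, and $2z\cdot[x,y]=[z\cdot x,y]+[x,z\cdot y]$ for all $x,y,z\in P$. (It is regarded as a Gelfand--Dorfman algebra with product $x\circ y=x\cdot y$.) $P$ is solvable if the derived series $P^{(0)}=P$, $P^{(n+1)}=P^{(n)}\cdot P^{(n)}+[P^{(n)},P^{(n)}]$ (linear spans) reaches $0$. The algebra $(P,\cdot)$, respectively $(P,[\cdot,\cdot])$, is solvable if the analogous series using only $\cdot$, respectively only $[\cdot,\cdot]$, reaches $0$. *)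

theory Defs
  imports "HOL-Computational_Algebra.Polynomial"
begin

text \<open>
  The underlying vector space of an algebra is the whole type \<open>'a\<close>, with scalar multiplication
  \<open>scale\<close>. The product of an algebra is an arbitrary bilinear map, so that the derived series is
  defined once and used both for \<open>(P, \<cdot>)\<close> and for \<open>(P, [\<cdot>,\<cdot>])\<close>.
\<close>

locale bilinear_algebra = vector_space scale
  for scale :: "'k::field \<Rightarrow> 'a::ab_group_add \<Rightarrow> 'a" +
  fixes prd :: "'a \<Rightarrow> 'a \<Rightarrow> 'a"
  assumes linear_right: "Vector_Spaces.linear scale scale (\<lambda>y. prd x y)"
    and linear_left: "Vector_Spaces.linear scale scale (\<lambda>x. prd x y)"
begin

definition product_space :: "'a set \<Rightarrow> 'a set \<Rightarrow> 'a set" where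
  "product_space A B = span {prd x y |x y. x \<in> A \<and> y \<in> B}"

primrec derived_series :: "nat \<Rightarrow> 'a set" where
  "derived_series 0 = UNIV"
| "derived_series (Suc n) = product_space (derived_series n) (derived_series n)"

definition solvable :: bool where
  "solvable \<longleftrightarrow> (\<exists>n. derived_series n = {0})"

end

locale comm_assoc_algebra = bilinear_algebra scale mult
  for scale :: "'k::field \<Rightarrow> 'a::ab_group_add \<Rightarrow> 'a"
    and mult :: "'a \<Rightarrow> 'a \<Rightarrow> 'a" +
  assumes mult_commute: "mult x y = mult y x"
    and mult_assoc: "mult (mult x y) z = mult x (mult y z)"

locale lie_algebra = bilinear_algebra scale bracket
  for scale :: "'k::field \<Rightarrow> 'a::ab_group_add \<Rightarrow> 'a"
    and bracket :: "'a \<Rightarrow> 'a \<Rightarrow> 'a" +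
  assumes bracket_self: "bracket x x = 0"
    and jacobi: "bracket x (bracket y z) + bracket y (bracket z x) + bracket z (bracket x y) = 0"

locale transposed_poisson_algebra =
  vector_space scale + mult: comm_assoc_algebra scale mult + lie: lie_algebra scale bracket
  for scale :: "'k::field \<Rightarrow> 'a::ab_group_add \<Rightarrow> 'a"
    and mult :: "'a \<Rightarrow> 'a \<Rightarrow> 'a"
    and bracket :: "'a \<Rightarrow> 'a \<Rightarrow> 'a" +
  assumes transposed_leibniz:
    "scale 2 (mult z (bracket x y)) = bracket (mult z x) y + bracket x (mult z y)"
begin

primrec derived_series :: "nat \<Rightarrow> 'a set" where
  "derived_series 0 = UNIV"
| "derived_series (Suc n) =
    {u + v |u v. u \<in> mult.product_space (derived_series n) (derived_series n) \<and>
                 v \<in> lie.product_space (derived_series n) (derived_series n)}"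

definition solvable :: bool where
  "solvable \<longleftrightarrow> (\<exists>n. derived_series n = {0})"

end

end

theory Submission
  imports Defs
begin

text \<open>
  Write \<open>M\<^sub>j\<close> and \<open>D\<^sub>k\<close> for the derived series of \<open>(P, \<cdot>)\<close> and of \<open>(P, [\<cdot>,\<cdot>])\<close>. Both are contained
  in the derived series of \<open>P\<close> termwise, so solvability of \<open>P\<close> passes to the two products.

  For the converse, divide the identity \<open>2 z [x,y] = [z x, y] + [x, z y]\<close> by \<open>2\<close>: it shows that
  \<open>z [x,y]\<close> is a linear combination of brackets of elements of \<open>A\<close> whenever \<open>x\<close> and \<open>y\<close> lie in
  an ideal \<open>A\<close> of \<open>(P, \<cdot>)\<close>. By induction every \<open>D\<^sub>k\<close> is an ideal of \<open>(P, \<cdot>)\<close>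
  (\<open>mult_lie_derived_series\<close>). Hence \<open>D\<^sub>k\<close> is closed under both products, \<open>D\<^sub>k\<^sub>+\<^sub>1\<close> is an
  ideal of it for both, and on the quotient \<open>D\<^sub>k / D\<^sub>k\<^sub>+\<^sub>1\<close> the bracket vanishes. On that quotient
  only the commutative product contributes to the derived series, and it dies after \<open>N\<close> steps if
  \<open>M\<^sub>N = 0\<close>. So every \<open>N\<close> steps the derived series of \<open>P\<close> descends from \<open>D\<^sub>k\<close> into \<open>D\<^sub>k\<^sub>+\<^sub>1\<close>
  (\<open>derived_series_descends\<close>), and it reaches \<open>0\<close> as soon as \<open>D\<^sub>k\<close> does.
\<close>

context bilinear_algebra
begin

lemma prd_add_left: "prd (x + y) z = prd x z + prd y z"
  using module_hom.add[OF linear_left[of z, folded module_hom_iff_linear]] .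

lemma prd_add_right: "prd x (y + z) = prd x y + prd x z"
  using module_hom.add[OF linear_right[of x, folded module_hom_iff_linear]] .

lemma subspace_derived_series: "subspace (derived_series n)"
  by (cases n) (simp_all add: product_space_def)

lemma prd_mem_product_space:
  "x \<in> A \<Longrightarrow> y \<in> B \<Longrightarrow> prd x y \<in> product_space A B"
  unfolding product_space_def by (blast intro: span_base)

lemma product_space_minimal:
  assumes "subspace S" and "\<And>x y. x \<in> A \<Longrightarrow> y \<in> B \<Longrightarrow> prd x y \<in> S"
  shows "product_space A B \<subseteq> S"
  unfolding product_space_def using assms by (intro span_minimal) auto

lemma product_space_mono: "A \<subseteq> A' \<Longrightarrow> B \<subseteq> B' \<Longrightarrow> product_space A B \<subseteq> product_space A' B'"
  unfolding product_space_def by (intro span_mono) blast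

lemma derived_series_Suc_subset: "derived_series (Suc n) \<subseteq> derived_series n"
proof (induction n)
  case (Suc n)
  then show ?case
    by (simp add: product_space_mono)
qed simp

end

context transposed_poisson_algebra
begin

lemma subspace_derived_series: "subspace (derived_series n)"
proof (cases n)
  case (Suc m)
  then show ?thesis
    by (simp add: subspace_sums mult.product_space_def lie.product_space_def)
qed simp

lemma derived_series_Suc_subset_iff:
  assumes "subspace S"
  shows "derived_series (Suc n) \<subseteq> S \<longleftrightarrow>
    mult.product_space (derived_series n) (derived_series n) \<subseteq> S \<and>
    lie.product_space (derived_series n) (derived_series n) \<subseteq> S"
    (is "_ \<longleftrightarrow> ?M \<subseteq> S \<and> ?L \<subseteq> S")
proof -
  have "0 \<in> ?M" "0 \<in> ?L"
    by (simp_all add: mult.product_space_def lie.product_space_def span_zero)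
  then have "?M \<subseteq> derived_series (Suc n)" "?L \<subseteq> derived_series (Suc n)"
    by force+
  moreover have "derived_series (Suc n) \<subseteq> S" if "?M \<subseteq> S" "?L \<subseteq> S"
    using that assms by (auto intro!: subspace_add)
  ultimately show ?thesis
    by blast
qed

lemma mult_derived_series_subset: "mult.derived_series n \<subseteq> derived_series n"
proof (induction n)
  case (Suc n)
  then have "mult.derived_series (Suc n) \<subseteq> mult.product_space (derived_series n) (derived_series n)"
    by (simp add: mult.product_space_mono)
  also have "\<dots> \<subseteq> derived_series (Suc n)"
    using derived_series_Suc_subset_iff[OF subspace_derived_series, of n "Suc n"] by blast
  finally show ?case .
qed simp

lemma lie_derived_series_subset: "lie.derived_series n \<subseteq> derived_series n"
proof (induction n)
  case (Suc n)
  then have "lie.derived_series (Suc n) \<subseteq> lie.product_space (derived_series n) (derived_series n)"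
    by (simp add: lie.product_space_mono)
  also have "\<dots> \<subseteq> derived_series (Suc n)"
    using derived_series_Suc_subset_iff[OF subspace_derived_series, of n "Suc n"] by blast
  finally show ?case .
qed simp

lemma solvable_imp_mult_lie_solvable:
  assumes "solvable"
  shows "mult.solvable" and "lie.solvable"
proof -
  from assms obtain n where "derived_series n = {0}"
    unfolding solvable_def by blast
  then have "mult.derived_series n = {0}" and "lie.derived_series n = {0}"
    using mult_derived_series_subset[of n] lie_derived_series_subset[of n]
      subspace_0[OF mult.subspace_derived_series[of n]]
      subspace_0[OF lie.subspace_derived_series[of n]]
    by auto
  then show "mult.solvable" and "lie.solvable"
    unfolding mult.solvable_def lie.solvable_def by blast+
qed

text \<open>
  Half the transposed Leibniz identity writes \<open>z [x,y]\<close> as a combination of \<open>[z x, y]\<close> and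
  \<open>[x, z y]\<close>, and if \<open>x\<close> and \<open>y\<close> lie in an ideal of \<open>(P, \<cdot>)\<close>, then so do \<open>z x\<close> and \<open>z y\<close>. The
  derived series therefore inherits ideality from \<open>D\<^sub>0 = P\<close>.
\<close>

lemma mult_lie_derived_series:
  assumes two: "(2::'k) \<noteq> 0"
  shows "x \<in> lie.derived_series k \<Longrightarrow> mult z x \<in> lie.derived_series k"
proof (induction k arbitrary: x)
  case (Suc k)
  let ?D = "lie.derived_series (Suc k)"
  note sub = lie.subspace_derived_series[of "Suc k"]
  \<comment> \<open>Products with \<open>z\<close> can be checked on brackets, because the preimage of \<open>D\<^sub>k\<^sub>+\<^sub>1\<close> under
    multiplication by \<open>z\<close> is a subspace.\<close>
  have "lie.product_space (lie.derived_series k) (lie.derived_series k) \<subseteq> mult z -` ?D"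
  proof (rule lie.product_space_minimal)
    show "subspace (mult z -` ?D)"
      using module_hom.subspace_vimage[OF mult.linear_right[folded module_hom_iff_linear] sub] .
  next
    fix x y
    assume "x \<in> lie.derived_series k" "y \<in> lie.derived_series k"
    then have "bracket (mult z x) y + bracket x (mult z y) \<in> ?D"
      using Suc.IH subspace_add[OF sub] by (simp add: lie.prd_mem_product_space)
    then have "scale 2 (mult z (bracket x y)) \<in> ?D"
      by (simp only: transposed_leibniz)
    then have "scale (inverse 2) (scale 2 (mult z (bracket x y))) \<in> ?D"
      by (rule subspace_scale[OF sub])
    with two show "bracket x y \<in> mult z -` ?D"
      by simp
  qed
  with Suc.prems show ?case
    by auto
qed simp

text \<open>
  This is the computation of the derived series modulo \<open>D\<^sub>k\<^sub>+\<^sub>1\<close>: all brackets of elements of \<open>D\<^sub>k\<close>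
  vanish there, so \<open>j\<close> further steps can leave no more than the image of \<open>M\<^sub>j\<close>. Containment in
  \<open>D\<^sub>k\<close> is carried along since it is what sends the brackets into \<open>D\<^sub>k\<^sub>+\<^sub>1\<close> at each step.
\<close>

lemma derived_series_descends:
  assumes two: "(2::'k) \<noteq> 0"
    and start: "derived_series n \<subseteq> lie.derived_series k"
  shows "derived_series (n + j) \<subseteq> lie.derived_series k \<inter>
    {u + v |u v. u \<in> mult.derived_series j \<and> v \<in> lie.derived_series (Suc k)}"
    (is "_ \<subseteq> ?D \<inter> ?S j")
proof (induction j)
  case 0
  have "x \<in> ?S 0" for x
    using subspace_0[OF lie.subspace_derived_series, of "Suc k"]
    by (simp del: lie.derived_series.simps) (metis add.right_neutral)
  with start show ?case
    by auto
next
  case (Suc j)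
  let ?D' = "lie.derived_series (Suc k)"
  note ideal = mult_lie_derived_series[OF two]
  note sub = lie.subspace_derived_series
  have subS: "subspace (?S (Suc j))"
    by (intro subspace_sums mult.subspace_derived_series sub)
  then have "subspace (?D \<inter> ?S (Suc j))"
    by (intro subspace_inter sub)
  moreover have "mult.product_space (derived_series (n + j)) (derived_series (n + j))
      \<subseteq> ?D \<inter> ?S (Suc j)"
  proof (rule mult.product_space_minimal)
    fix x y
    assume x: "x \<in> derived_series (n + j)" and y: "y \<in> derived_series (n + j)"
    from x Suc obtain u v where u: "u \<in> mult.derived_series j" and v: "v \<in> ?D'"
      and xeq: "x = u + v"
      by blast
    from y Suc obtain u' v' where u': "u' \<in> mult.derived_series j" and v': "v' \<in> ?D'"
      and yeq: "y = u' + v'"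
      by blast
    have "mult x y = mult u u' + (mult u' v + mult x v')"
      unfolding xeq yeq
      by (simp add: mult.prd_add_left mult.prd_add_right mult.mult_commute[of v u'] algebra_simps)
    moreover have "mult u u' \<in> mult.derived_series (Suc j)"
      using u u' by (simp add: mult.prd_mem_product_space)
    moreover have "mult u' v + mult x v' \<in> ?D'"
      using ideal v v' by (intro subspace_add[OF sub])
    ultimately have "mult x y \<in> ?S (Suc j)"
      by blast
    moreover have "mult x y \<in> ?D"
      using ideal y Suc by blast
    ultimately show "mult x y \<in> ?D \<inter> ?S (Suc j)"
      by blast
  qed fact
  moreover have "lie.product_space (derived_series (n + j)) (derived_series (n + j))
      \<subseteq> ?D \<inter> ?S (Suc j)"
  proof -
    have "lie.product_space (derived_series (n + j)) (derived_series (n + j)) \<subseteq> ?D'"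
      using Suc by (simp add: lie.product_space_mono)
    moreover have "?D' \<subseteq> ?D"
      by (rule lie.derived_series_Suc_subset)
    moreover have "?D' \<subseteq> ?S (Suc j)"
      using subspace_0[OF mult.subspace_derived_series, of "Suc j"]
      by (force simp del: lie.derived_series.simps mult.derived_series.simps)
    ultimately show ?thesis
      by blast
  qed
  ultimately show ?case
    by (simp only: add_Suc_right derived_series_Suc_subset_iff)
qed

lemma derived_series_subset_lie_derived_series:
  assumes "(2::'k) \<noteq> 0" and "mult.derived_series N = {0}"
  shows "derived_series (k * N) \<subseteq> lie.derived_series k"
proof (induction k)
  case (Suc k)
  have "derived_series (k * N + N) \<subseteq> lie.derived_series (Suc k)"
    using derived_series_descends[OF assms(1) Suc, of N] assms(2)
    by (auto simp del: lie.derived_series.simps)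
  then show ?case
    by (simp only: mult_Suc add.commute)
qed simp

theorem solvable_iff_mult_lie_solvable:
  assumes "(2::'k) \<noteq> 0"
  shows "solvable \<longleftrightarrow> mult.solvable \<and> lie.solvable"
proof
  assume "mult.solvable \<and> lie.solvable"
  then obtain N k where "mult.derived_series N = {0}" and "lie.derived_series k = {0}"
    unfolding mult.solvable_def lie.solvable_def by blast
  then have "derived_series (k * N) \<subseteq> {0}"
    using derived_series_subset_lie_derived_series[OF assms, of N k] by simp
  then have "derived_series (k * N) = {0}"
    using subspace_0[OF subspace_derived_series[of "k * N"]] by blast
  then show "solvable"
    unfolding solvable_def by blast
qed (use solvable_imp_mult_lie_solvable in blast)

end

theorem corollary4p6:
  fixes scale :: "'k::{alg_closed_field, field_char_0} \<Rightarrow> 'a::ab_group_add \<Rightarrow> 'a"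
    and mult bracket :: "'a \<Rightarrow> 'a \<Rightarrow> 'a"
    and Basis :: "'a set"
  assumes "transposed_poisson_algebra scale mult bracket"
    and "finite_dimensional_vector_space scale Basis"
  shows "transposed_poisson_algebra.solvable scale mult bracket \<longleftrightarrow>
    bilinear_algebra.solvable scale mult \<and> bilinear_algebra.solvable scale bracket"
  using transposed_poisson_algebra.solvable_iff_mult_lie_solvable[OF assms(1)] by simp

end
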